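(* No reordered computable number is Martin-Löf random.
   Context: $\mathbb{N}=\{0,1,2,\dots\}$. A function $f\colon\mathbb{N}\to\mathbb{N}$ tends to infinity if for every $c$ there is $m$ with $f(n)>c$ for all $n\ge m$. For such $f$, $u_f(n) := |\{k\in\mathbb{N} \mid f(k)=n\}|$. A function $f\colon\mathbb{N}\to\mathbb{N}$ is a name for a real number $x$ if $\sum_{k=0}^\infty 2^{-f(k)} = x$ (then $f$ tends to infinity). A convergent sequence $(x_n)_n$ with limit $x$ converges computably if there is a computable $s\colon\mathbb{N}\to\mathbb{N}$ with $|x-x_k|\le 2^{-n}$ for all $n$ and all $k\ge s(n)$; a series converges computably if the sequence of its partial sums $\left(\sum_{k=0}^{n-1}a_k\right)_n$ does (no computability of the terms is required). A real number is reordered computable if it has a computable name $f$ such that $\sum_{k=0}^\infty u_f(k)\cdot 2^{-k}$ converges computably. Martin-Löf randomness is the standard notion: a real is Martin-Löf random if there is no uniformly computably enumerable sequence $(U_n)_n$ of open sets (each a c.e. union of open rational intervals) with Lebesgue measure $\lambda(U_n)\le 2^{-n}$ for all $n$ and $x\in\bigcap_n U_n$. *)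

theory Defs
  imports "HOL-Analysis.Analysis" "HOL-Library.Nat_Bijection" "HOL-Library.Countable"
begin

section \<open>Computable functions and c.e. sets\<close>

text \<open>Partial recursive functions: \<open>Comp f gs\<close> is composition, \<open>PrimRec f g\<close> recurses on the
  first argument, and \<open>Mu f\<close> searches for the least first argument at which \<open>f\<close> vanishes.\<close>

datatype recf = Zero | Succ | Proj nat | Comp recf "recf list" | PrimRec recf recf | Mu recf

text \<open>\<open>computes r xs y\<close>: the program \<open>r\<close> halts on the arguments \<open>xs\<close> with output \<open>y\<close>.\<close>

inductive computes :: "recf \<Rightarrow> nat list \<Rightarrow> nat \<Rightarrow> bool" where
  zero: "computes Zero xs 0"
| succ: "computes Succ [x] (Suc x)"
| proj: "i < length xs \<Longrightarrow> computes (Proj i) xs (xs ! i)"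
| comp: "list_all2 (\<lambda>g y. computes g xs y) gs ys \<Longrightarrow> computes f ys z \<Longrightarrow> computes (Comp f gs) xs z"
| primrec_0: "computes f xs y \<Longrightarrow> computes (PrimRec f g) (0 # xs) y"
| primrec_Suc: "computes (PrimRec f g) (n # xs) y \<Longrightarrow> computes g (n # y # xs) z
    \<Longrightarrow> computes (PrimRec f g) (Suc n # xs) z"
| mu: "computes f (n # xs) 0 \<Longrightarrow> (\<forall>m<n. \<exists>y. y \<noteq> 0 \<and> computes f (m # xs) y)
    \<Longrightarrow> computes (Mu f) xs n"

lemma computes_deterministic:
  "computes r xs y \<Longrightarrow> computes r xs z \<Longrightarrow> y = z"
proof (induction arbitrary: z rule: computes.induct)
  case (zero xs)
  then show ?case by (auto elim: computes.cases)
next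
  case (succ x)
  then show ?case by (auto elim: computes.cases)
next
  case (proj i xs)
  from proj.prems show ?case by cases auto
next
  case (comp xs gs ys f w)
  from comp.prems show ?case
  proof cases
    case (comp ys')
    have "ys = ys'"
      using comp.IH(1) comp(1) by (auto simp: list_all2_conv_all_nth intro!: nth_equalityI)
    then show ?thesis using comp.IH(2) comp(2) by blast
  qed
next
  case (primrec_0 f xs y g)
  from primrec_0.prems show ?case using primrec_0.IH by cases auto
next
  case (primrec_Suc f g n xs y w)
  from primrec_Suc.prems show ?case using primrec_Suc.IH by cases auto
next
  case (mu f n xs)
  from mu.prems show ?case
  proof cases
    case mu': mu
    show ?thesis
    proof (rule linorder_cases[of n z])
      assume "n < z"
      with mu'(2) mu.IH(1) show ?thesis by fastforce
    next
      assume "z < n"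
      with mu'(1) mu.IH(2) show ?thesis by fastforce
    qed
  qed
qed

definition computable :: "(nat \<Rightarrow> nat) \<Rightarrow> bool" where
  "computable f \<longleftrightarrow> (\<exists>r. \<forall>n. computes r [n] (f n))"

definition ce :: "nat set \<Rightarrow> bool" where
  "ce W \<longleftrightarrow> (\<exists>r. W = {n. \<exists>y. computes r [n] y})"


section \<open>Martin-Loef randomness\<close>

text \<open>The library function \<open>nat_to_rat_surj\<close> is an effective enumeration of the rationals: it
  decodes its argument into two integers and forms their quotient. Codes \<open>c\<close> whose left endpoint
  is not below the right one denote the empty interval.\<close>

definition rat_interval :: "nat \<Rightarrow> real set" where
  "rat_interval c = (case prod_decode c of (i, j) \<Rightarrow>
     {of_rat (nat_to_rat_surj i) <..< of_rat (nat_to_rat_surj j)})"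

definition uniformly_ce_open :: "(nat \<Rightarrow> real set) \<Rightarrow> bool" where
  "uniformly_ce_open U \<longleftrightarrow>
     (\<exists>W. ce W \<and> (\<forall>n. U n = (\<Union>c\<in>{c. prod_encode (n, c) \<in> W}. rat_interval c)))"

definition ml_random :: "real \<Rightarrow> bool" where
  "ml_random x \<longleftrightarrow>
     \<not> (\<exists>U. uniformly_ce_open U \<and> (\<forall>n. emeasure lborel (U n) \<le> ennreal (1 / 2 ^ n)) \<and>
          x \<in> (\<Inter>n. U n))"


section \<open>Names and reordered computable numbers\<close>

definition name_for :: "(nat \<Rightarrow> nat) \<Rightarrow> real \<Rightarrow> bool" where
  "name_for f x \<longleftrightarrow> (\<lambda>k. 1 / 2 ^ f k) sums x"

definition converges_computably :: "(nat \<Rightarrow> real) \<Rightarrow> bool" where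
  "converges_computably X \<longleftrightarrow>
     (\<exists>x. X \<longlonglongrightarrow> x \<and> (\<exists>s. computable s \<and> (\<forall>n. \<forall>k\<ge>s n. \<bar>x - X k\<bar> \<le> 1 / 2 ^ n)))"

definition series_converges_computably :: "(nat \<Rightarrow> real) \<Rightarrow> bool" where
  "series_converges_computably a \<longleftrightarrow> converges_computably (\<lambda>n. \<Sum>k<n. a k)"

definition u_count :: "(nat \<Rightarrow> nat) \<Rightarrow> nat \<Rightarrow> nat" where
  "u_count f n = card {k. f k = n}"

text \<open>A name tends to infinity, so \<open>u_count\<close> only counts finite sets when applied to a name.\<close>

lemma name_for_tends_to_infinity:
  assumes "name_for f x"
  shows "filterlim f at_top sequentially"
proof (rule filterlim_at_top[THEN iffD2, rule_format])
  fix c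
  have "(\<lambda>k. 1 / 2 ^ f k :: real) \<longlonglongrightarrow> 0"
    using assms by (auto simp: name_for_def intro: summable_LIMSEQ_zero sums_summable)
  then have "\<forall>\<^sub>F k in sequentially. 1 / 2 ^ f k < (1 / 2 ^ c :: real)"
    by (rule order_tendstoD) simp
  then show "\<forall>\<^sub>F k in sequentially. c \<le> f k"
    by eventually_elim (simp add: divide_simps)
qed

lemma finite_name_for_fibre:
  assumes "name_for f x"
  shows "finite {k. f k = n}"
proof -
  have "\<forall>\<^sub>F k in sequentially. Suc n \<le> f k"
    using name_for_tends_to_infinity[OF assms] by (simp add: filterlim_at_top)
  then obtain m where "\<And>k. k \<ge> m \<Longrightarrow> Suc n \<le> f k"
    by (auto simp: eventually_sequentially)
  then have "{k. f k = n} \<subseteq> {..<m}"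
    by (force simp: not_le[symmetric])
  then show ?thesis
    by (rule finite_subset) simp
qed

definition reordered_computable :: "real \<Rightarrow> bool" where
  "reordered_computable x \<longleftrightarrow>
     (\<exists>f. computable f \<and> name_for f x \<and> series_converges_computably (\<lambda>k. real (u_count f k) / 2 ^ k))"

end

theory Submission
  imports Defs
begin

text \<open>Let \<open>f\<close> be a computable name of \<open>x\<close>, let \<open>x\<^sub>t = (\<Sum>k<t. 1 / 2 ^ f k)\<close>, and let
  \<open>s\<close> be a modulus for the reordered series. Fix \<open>n\<close>, put \<open>m = s n\<close> and
  \<open>\<delta> = 1 / 2 ^ (m + n)\<close>, and slide the window \<open>{x\<^sub>t <..< x\<^sub>t + \<delta>}\<close> along the
  increasing computable sequence \<open>x\<^sub>t\<close>. Since \<open>x\<^sub>t < x\<close> and \<open>x\<^sub>t \<longlonglongrightarrow> x\<close>, some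
  window contains \<open>x\<close>.

  The union of the windows is small because each step is charged according to its size. A step of
  size \<open>h\<close> adds to the union a set of measure at most \<open>min h \<delta>\<close>. A large step, one with
  \<open>f k < m\<close>, is charged \<open>\<delta>\<close>; it has size more than \<open>1 / 2 ^ m\<close>, so there are at most
  \<open>2 ^ m * x\<close> large steps, and together they cost at most \<open>x / 2 ^ n\<close>. A small step, one with
  \<open>m \<le> f k\<close>, is charged its size; reordering the small steps by exponent turns their sum into part
  of the tail of the reordered series from \<open>m\<close> on, which is at most \<open>1 / 2 ^ n\<close> by the choice of
  \<open>m\<close>. With the initial window the total is at most \<open>(x + 2) / 2 ^ n\<close>, and a shift of \<open>n\<close> by
  a constant \<open>c\<close> with \<open>x + 2 < 2 ^ c\<close> gives a Martin-Loef test that captures \<open>x\<close>. The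
  charging argument is \<open>emeasure_sliding_windows_finite\<close>, the two bounds are
  \<open>card_small_exponents\<close> and \<open>tail_le_modulus\<close>.

  The windows are effective: \<open>x\<^sub>t\<close> and \<open>\<delta>\<close> are dyadic rationals with computable numerators and
  exponents, so codes of the windows are computed from \<open>n\<close> and \<open>t\<close>, and the set of all these
  codes is the range of a computable function (\<open>uniformly_ce_open_partial_sums\<close>).\<close>

section \<open>Closure properties of recursive functions\<close>

text \<open>Functions of several arguments are represented on lists, so that a parameter can be read off
  by an expression inside \<open>F\<close>; the closure rules below then apply to a term directly by following
  its structure.\<close>

definition recursive :: "nat \<Rightarrow> (nat list \<Rightarrow> nat) \<Rightarrow> bool" where
  "recursive k F \<longleftrightarrow> (\<exists>r. \<forall>xs. length xs = k \<longrightarrow> computes r xs (F xs))"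

lemma recursive_nth: "i < k \<Longrightarrow> recursive k (\<lambda>xs. xs ! i)"
  unfolding recursive_def by (metis computes.proj)

lemma recursive_computable:
  assumes "computable h" "recursive k F"
  shows "recursive k (\<lambda>xs. h (F xs))"
proof -
  obtain r q where r: "\<And>n. computes r [n] (h n)"
    and q: "\<And>xs. length xs = k \<Longrightarrow> computes q xs (F xs)"
    using assms unfolding computable_def recursive_def by blast
  have "computes (Comp r [q]) xs (h (F xs))" if "length xs = k" for xs
    by (rule computes.comp[where ys = "[F xs]"]) (use that r q in auto)
  then show ?thesis unfolding recursive_def by blast
qed

lemma recursive_binary:
  assumes "recursive 2 (\<lambda>ys. h (ys ! 0) (ys ! 1))" "recursive k A" "recursive k B"
  shows "recursive k (\<lambda>xs. h (A xs) (B xs))"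
proof -
  obtain r where "\<forall>ys. length ys = 2 \<longrightarrow> computes r ys (h (ys ! 0) (ys ! 1))"
    using assms(1) unfolding recursive_def by blast
  from this[rule_format, of "[_, _]"] have r: "computes r [a, b] (h a b)" for a b
    by simp
  obtain p q where p: "\<And>xs. length xs = k \<Longrightarrow> computes p xs (A xs)"
    and q: "\<And>xs. length xs = k \<Longrightarrow> computes q xs (B xs)"
    using assms unfolding recursive_def by blast
  have "computes (Comp r [p, q]) xs (h (A xs) (B xs))" if "length xs = k" for xs
    by (rule computes.comp[where ys = "[A xs, B xs]"]) (use that r p q in auto)
  then show ?thesis unfolding recursive_def by blast
qed

lemma computable_Suc: "computable Suc"
  unfolding computable_def by (blast intro: computes.succ)

lemma recursive_const: "recursive k (\<lambda>xs. c)"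
proof (induction c)
  case 0
  then show ?case unfolding recursive_def by (blast intro: computes.zero)
next
  case (Suc c)
  then show ?case by (rule recursive_computable[OF computable_Suc])
qed

text \<open>The step of a primitive recursion sees the counter and the previous value in front of the
  parameters. Functions of the parameters alone are reused there by skipping these two entries.\<close>

lemma recursive_drop:
  assumes "recursive k F"
  shows "recursive (Suc (Suc k)) (\<lambda>ys. F (drop 2 ys))"
proof -
  obtain r where r: "\<And>xs. length xs = k \<Longrightarrow> computes r xs (F xs)"
    using assms unfolding recursive_def by blast
  have "computes (Comp r (map Proj [2..<Suc (Suc k)])) ys (F (drop 2 ys))"
    if "length ys = Suc (Suc k)" for ys
  proof (rule computes.comp[where ys = "drop 2 ys"])
    show "computes r (drop 2 ys) (F (drop 2 ys))" using r that by simp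
    show "list_all2 (\<lambda>g y. computes g ys y) (map Proj [2..<Suc (Suc k)]) (drop 2 ys)"
      unfolding list_all2_conv_all_nth using that
      by (auto simp del: upt_Suc intro!: computes.proj)
  qed
  then show ?thesis unfolding recursive_def by blast
qed

lemma recursive_rec_nat:
  assumes "recursive k N" "recursive k G"
    and "recursive (Suc (Suc k)) (\<lambda>ys. H (ys ! 0) (ys ! 1) (drop 2 ys))"
  shows "recursive k (\<lambda>xs. rec_nat (G xs) (\<lambda>n y. H n y xs) (N xs))"
proof -
  obtain rn rg rh where rn: "\<And>xs. length xs = k \<Longrightarrow> computes rn xs (N xs)"
    and rg: "\<And>xs. length xs = k \<Longrightarrow> computes rg xs (G xs)"
    and rh: "\<And>ys. length ys = Suc (Suc k) \<Longrightarrow> computes rh ys (H (ys ! 0) (ys ! 1) (drop 2 ys))"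
    using assms unfolding recursive_def by blast
  have pr: "computes (PrimRec rg rh) (n # xs) (rec_nat (G xs) (\<lambda>n y. H n y xs) n)"
    if "length xs = k" for n xs
  proof (induction n)
    case 0
    then show ?case using rg[OF that] by (auto intro: computes.primrec_0)
  next
    case (Suc n)
    show ?case
      by (rule computes.primrec_Suc[OF Suc]) (use rh[of "n # _ # xs"] that in auto)
  qed
  have "computes (Comp (PrimRec rg rh) (rn # map Proj [0..<k])) xs
      (rec_nat (G xs) (\<lambda>n y. H n y xs) (N xs))" if "length xs = k" for xs
    by (rule computes.comp[OF _ pr])
      (use that rn in \<open>auto simp: list_all2_conv_all_nth nth_Cons' intro: computes.proj\<close>)
  then show ?thesis unfolding recursive_def by blast
qed

lemma computable_iff_recursive: "computable h \<longleftrightarrow> recursive 1 (\<lambda>xs. h (xs ! 0))"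
  unfolding computable_def recursive_def
  by (rule iff_exI) (metis One_nat_def length_0_conv length_Suc_conv nth_Cons_0)

lemma recursive_add:
  assumes "recursive k A" "recursive k B"
  shows "recursive k (\<lambda>xs. A xs + B xs)"
proof -
  have "rec_nat b (\<lambda>n y. Suc y) a = a + b" for a b by (induction a) auto
  moreover have "recursive k (\<lambda>xs. rec_nat (B xs) (\<lambda>n y. Suc y) (A xs))"
    by (intro recursive_rec_nat assms recursive_computable[OF computable_Suc] recursive_nth) simp
  ultimately show ?thesis by simp
qed

lemma recursive_mult:
  assumes "recursive k A" "recursive k B"
  shows "recursive k (\<lambda>xs. A xs * B xs)"
proof -
  have "rec_nat 0 (\<lambda>n y. y + b) a = a * b" for a b by (induction a) auto
  moreover have "recursive k (\<lambda>xs. rec_nat 0 (\<lambda>n y. y + B xs) (A xs))"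
    by (intro recursive_rec_nat assms recursive_add recursive_drop recursive_nth recursive_const) simp
  ultimately show ?thesis by simp
qed

lemma recursive_power:
  assumes "recursive k A" "recursive k B"
  shows "recursive k (\<lambda>xs. A xs ^ B xs)"
proof -
  have "rec_nat 1 (\<lambda>n y. y * a) b = a ^ b" for a b :: nat by (induction b) auto
  moreover have "recursive k (\<lambda>xs. rec_nat 1 (\<lambda>n y. y * A xs) (B xs))"
    by (intro recursive_rec_nat assms recursive_mult recursive_drop recursive_nth recursive_const) simp
  ultimately show ?thesis by simp
qed

lemma recursive_diff:
  assumes "recursive k A" "recursive k B"
  shows "recursive k (\<lambda>xs. A xs - B xs)"
proof -
  have "rec_nat 0 (\<lambda>n y. n) a = a - 1" for a by (cases a) auto
  moreover have "recursive 1 (\<lambda>xs. rec_nat 0 (\<lambda>n y. n) (xs ! 0))"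
    by (intro recursive_rec_nat recursive_nth recursive_const) auto
  ultimately have pred: "computable (\<lambda>a. a - 1)"
    by (simp add: computable_iff_recursive)
  have "rec_nat a (\<lambda>n y. y - 1) b = a - b" for a b :: nat by (induction b) auto
  moreover have "recursive k (\<lambda>xs. rec_nat (A xs) (\<lambda>n y. y - 1) (B xs))"
    by (intro recursive_rec_nat assms recursive_computable[OF pred] recursive_nth) simp
  ultimately show ?thesis by simp
qed

lemma recursive_prod_encode:
  assumes "recursive k A" "recursive k B"
  shows "recursive k (\<lambda>xs. prod_encode (A xs, B xs))"
proof -
  have "rec_nat 0 (\<lambda>n y. y + Suc n) a = triangle a" for a by (induction a) auto
  moreover have "recursive 1 (\<lambda>xs. rec_nat 0 (\<lambda>n y. y + Suc n) (xs ! 0))"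
    by (intro recursive_rec_nat recursive_nth recursive_const recursive_add
        recursive_computable[OF computable_Suc]) auto
  ultimately have "computable triangle" by (simp add: computable_iff_recursive)
  then show ?thesis unfolding prod_encode_def prod.case
    by (intro recursive_add recursive_computable[of triangle] assms)
qed

lemma computable_recursion:
  assumes "recursive 2 (\<lambda>ys. H (ys ! 0) (ys ! 1))"
  shows "computable (rec_nat c H)"
  unfolding computable_iff_recursive
  by (intro recursive_rec_nat recursive_binary[OF assms] recursive_nth recursive_const) auto

lemma ce_search:
  assumes "recursive 2 F"
  shows "ce {w. \<exists>t. F [t, w] = 0}"
proof -
  obtain r where "\<forall>xs. length xs = 2 \<longrightarrow> computes r xs (F xs)"
    using assms unfolding recursive_def by blast
  then have r: "computes r [t, w] (F [t, w])" for t w by simp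
  have "(\<exists>y. computes (Mu r) [w] y) \<longleftrightarrow> (\<exists>t. F [t, w] = 0)" for w
  proof
    assume "\<exists>y. computes (Mu r) [w] y"
    then obtain t where "computes (Mu r) [w] t" by blast
    then have "computes r [t, w] 0" by cases
    then show "\<exists>t. F [t, w] = 0" using r computes_deterministic by metis
  next
    assume "\<exists>t. F [t, w] = 0"
    then have "F [LEAST t. F [t, w] = 0, w] = 0" by (rule LeastI_ex)
    then have "computes (Mu r) [w] (LEAST t. F [t, w] = 0)"
      using r not_less_Least by (metis (mono_tags, lifting) computes.mu)
    then show "\<exists>y. computes (Mu r) [w] y" by blast
  qed
  then have "{w. \<exists>t. F [t, w] = 0} = {w. \<exists>y. computes (Mu r) [w] y}" by simp
  then show ?thesis unfolding ce_def by blast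
qed

text \<open>The bound \<open>n \<le> g n t\<close> holds for pair codes with first component \<open>n\<close>. It confines \<open>n\<close>
  to \<open>{..w}\<close>, so the search for a preimage of \<open>w\<close> is unbounded in \<open>t\<close> only.\<close>

lemma ce_range:
  assumes "recursive 2 (\<lambda>ys. g (ys ! 0) (ys ! 1))" and "\<And>n t. n \<le> g n t"
  shows "ce {w. \<exists>n t. g n t = w}"
proof -
  \<comment> \<open>the distance between \<open>g n t\<close> and \<open>w\<close>, from truncated subtraction; a product of
    distances vanishes iff one of the factors does\<close>
  define D where "D n t w = (g n t - w) + (w - g n t)" for n t w
  have "recursive 2 (\<lambda>xs. rec_nat 1 (\<lambda>n y. y * D n (xs ! 0) (xs ! 1)) (Suc (xs ! 1)))"
    unfolding D_def
    by (intro recursive_rec_nat recursive_const recursive_computable[OF computable_Suc]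
        recursive_mult recursive_add recursive_diff recursive_binary[OF assms(1)]
        recursive_drop[where F = "\<lambda>xs. xs ! 0"]
        recursive_drop[where F = "\<lambda>xs. xs ! 1"] recursive_nth) auto
  moreover have "rec_nat 1 (\<lambda>n y. y * D n t w) b = (\<Prod>n<b. D n t w)" for t w b
    by (induction b) auto
  ultimately have rec: "recursive 2 (\<lambda>xs. \<Prod>n<Suc (xs ! 1). D n (xs ! 0) (xs ! 1))" by simp
  have "(\<exists>n t. g n t = w) \<longleftrightarrow> (\<exists>t. (\<Prod>n<Suc w. D n t w) = 0)" for w
  proof -
    have "D n t w = 0 \<longleftrightarrow> g n t = w" for n t unfolding D_def by auto
    then have "(\<Prod>n<Suc w. D n t w) = 0 \<longleftrightarrow> (\<exists>n\<le>w. g n t = w)" for t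
      by (auto simp: less_Suc_eq_le simp del: prod.lessThan_Suc)
    then show ?thesis using assms(2) by metis
  qed
  then show ?thesis using ce_search[OF rec] by simp
qed

section \<open>Intervals with dyadic endpoints\<close>

text \<open>The library codes a nonnegative integer \<open>k\<close> by \<open>2 * k\<close>, which accounts for the
  factors.\<close>

definition fraction_code :: "nat \<Rightarrow> nat \<Rightarrow> nat" where
  "fraction_code a b = prod_encode (2 * a, 2 * b)"

lemma nat_to_rat_surj_fraction_code:
  "of_rat (nat_to_rat_surj (fraction_code a b)) = (real a / real b)"
proof -
  have "int_decode (2 * k) = int k" for k
    by (simp add: int_decode_def sum_decode_def)
  then show ?thesis
    by (simp add: nat_to_rat_surj_def fraction_code_def Fract_of_int_quotient of_rat_divide)
qed

lemma rat_interval_fraction_code: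
  "rat_interval (prod_encode (fraction_code a b, fraction_code c d)) =
     {real a / real b <..< real c / real d}"
  by (simp add: rat_interval_def nat_to_rat_surj_fraction_code)

text \<open>All terms of the \<open>t\<close>-th partial sum have the common denominator \<open>2 ^ (\<Sum>k<t. f k)\<close>. It
  is far from least, but it satisfies a simple recursion.\<close>

lemma partial_sums_computable_numerators:
  assumes "computable f"
  shows "\<exists>P q. computable P \<and> computable q \<and>
    (\<forall>t. (\<Sum>k<t. 1 / 2 ^ f k) = real (P t) / 2 ^ q t)"
proof -
  define q where "q = rec_nat 0 (\<lambda>k y. y + f k)"
  define P :: "nat \<Rightarrow> nat" where "P = rec_nat 0 (\<lambda>k y. y * 2 ^ f k + 2 ^ q k)"
  have q: "computable q" unfolding q_def
    by (intro computable_recursion recursive_add recursive_nth recursive_computable[OF assms]) auto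
  have P: "computable P" unfolding P_def
    by (intro computable_recursion recursive_add recursive_mult recursive_power recursive_const
        recursive_nth recursive_computable[OF assms] recursive_computable[OF q]) auto
  have "(\<Sum>k<t. 1 / 2 ^ f k) = real (P t) / 2 ^ q t" for t
    by (induction t) (simp_all add: P_def q_def power_add field_simps)
  then show ?thesis using q P by blast
qed

text \<open>Each window has one canonical code, computed from \<open>n\<close> and \<open>t\<close>. Enumerating only these
  codes avoids deciding which of the other codes denote subintervals of the windows.\<close>

lemma uniformly_ce_open_partial_sums:
  assumes "computable f" and "computable e"
  shows "uniformly_ce_open (\<lambda>n. \<Union>t. {(\<Sum>k<t. 1 / 2 ^ f k) <..< (\<Sum>k<t. 1 / 2 ^ f k) + 1 / 2 ^ e n})"
proof -
  obtain P q where P: "computable P" and q: "computable q"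
    and sums: "\<And>t. (\<Sum>k<t. 1 / 2 ^ f k) = real (P t) / 2 ^ q t"
    using partial_sums_computable_numerators[OF assms(1)] by blast
  define code where "code n t = prod_encode (fraction_code (P t) (2 ^ q t),
      fraction_code (P t * 2 ^ e n + 2 ^ q t) (2 ^ (q t + e n)))" for n t
  have interval: "rat_interval (code n t) =
      {(\<Sum>k<t. 1 / 2 ^ f k) <..< (\<Sum>k<t. 1 / 2 ^ f k) + 1 / 2 ^ e n}" for n t
    unfolding code_def rat_interval_fraction_code sums
    by (simp add: power_add field_simps)
  define W where "W = {w. \<exists>n t. prod_encode (n, code n t) = w}"
  have "ce W" unfolding W_def
  proof (rule ce_range)
    show "n \<le> prod_encode (n, code n t)" for n t by (rule le_prod_encode_1)
    show "recursive 2 (\<lambda>ys. prod_encode (ys ! 0, code (ys ! 0) (ys ! 1)))"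
      unfolding code_def fraction_code_def
      by (intro recursive_prod_encode recursive_add recursive_mult recursive_power recursive_const
          recursive_computable[OF P] recursive_computable[OF q]
          recursive_computable[OF assms(2)] recursive_nth) auto
  qed
  moreover have "(\<Union>t. {(\<Sum>k<t. 1 / 2 ^ f k) <..< (\<Sum>k<t. 1 / 2 ^ f k) + 1 / 2 ^ e n}) =
      (\<Union>c\<in>{c. prod_encode (n, c) \<in> W}. rat_interval c)" for n
  proof -
    have "{c. prod_encode (n, c) \<in> W} = range (code n)" unfolding W_def by auto
    then show ?thesis by (simp add: interval)
  qed
  ultimately show ?thesis unfolding uniformly_ce_open_def by blast
qed

section \<open>The measure bound\<close>

text \<open>When the window moves by \<open>h t\<close>, the new part of the union lies in the new window, of measure
  \<open>\<delta>\<close>, and also in the half-open strip of length \<open>h t\<close> beyond the right end of the old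
  window. The predicate \<open>Z\<close> selects the steps that are charged \<open>\<delta>\<close>; all others are charged
  \<open>h t\<close>. The summand \<open>1\<close> pays for the initial window.\<close>

lemma emeasure_sliding_windows_finite:
  fixes h :: "nat \<Rightarrow> real"
  assumes "\<And>k. 0 \<le> h k" and "0 \<le> \<delta>"
  shows "emeasure lborel (\<Union>i\<le>t. {sum h {..<i} <..< sum h {..<i} + \<delta>})
    \<le> ennreal (\<delta> * (1 + real (card {k. k < t \<and> Z k})) + sum h {k. k < t \<and> \<not> Z k})"
proof (induction t)
  case 0
  then show ?case using assms by simp
next
  case (Suc t)
  define X where "X i = sum h {..<i}" for i
  define A where "A = (\<Union>i\<le>t. {X i <..< X i + \<delta>})"
  have A_meas: "A \<in> sets lborel" unfolding A_def by auto
  have X_Suc: "X (Suc t) = X t + h t" unfolding X_def by simp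
  have A_Suc: "(\<Union>i\<le>Suc t. {X i <..< X i + \<delta>}) = A \<union> {X (Suc t) <..< X (Suc t) + \<delta>}"
    unfolding A_def by (auto simp: atMost_Suc)
  have nonneg: "0 \<le> sum h {k. k < t \<and> \<not> Z k}" by (intro sum_nonneg assms)
  let ?b = "\<delta> * (1 + real (card {k. k < t \<and> Z k})) + sum h {k. k < t \<and> \<not> Z k}"
  have b: "0 \<le> ?b" using nonneg assms by simp
  have IH: "emeasure lborel A \<le> ennreal ?b" using Suc unfolding A_def X_def .
  show ?case
  proof (cases "Z t")
    case True
    have split: "{k. k < Suc t \<and> Z k} = insert t {k. k < t \<and> Z k}"
      "{k. k < Suc t \<and> \<not> Z k} = {k. k < t \<and> \<not> Z k}"
      using True by (auto simp: less_Suc_eq)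
    have "emeasure lborel (A \<union> {X (Suc t) <..< X (Suc t) + \<delta>})
        \<le> emeasure lborel A + emeasure lborel {X (Suc t) <..< X (Suc t) + \<delta>}"
      by (rule emeasure_subadditive) (use A_meas in auto)
    also have "\<dots> \<le> ennreal ?b + ennreal \<delta>"
      using IH assms by (intro add_mono) auto
    also have "\<dots> = ennreal (?b + \<delta>)"
      using b assms by (simp add: ennreal_plus)
    finally show ?thesis
      using A_Suc unfolding X_def split by (simp add: algebra_simps)
  next
    case False
    have split: "{k. k < Suc t \<and> Z k} = {k. k < t \<and> Z k}"
      "{k. k < Suc t \<and> \<not> Z k} = insert t {k. k < t \<and> \<not> Z k}"
      using False by (auto simp: less_Suc_eq)
    have "{X t <..< X t + \<delta>} \<subseteq> A" unfolding A_def by auto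
    then have "A \<union> {X (Suc t) <..< X (Suc t) + \<delta>} \<subseteq> A \<union> {X t + \<delta> ..< X t + \<delta> + h t}"
      using assms(1)[of t] X_Suc by auto
    then have "emeasure lborel (A \<union> {X (Suc t) <..< X (Suc t) + \<delta>})
        \<le> emeasure lborel (A \<union> {X t + \<delta> ..< X t + \<delta> + h t})"
      by (rule emeasure_mono) (use A_meas in auto)
    also have "\<dots> \<le> emeasure lborel A + emeasure lborel {X t + \<delta> ..< X t + \<delta> + h t}"
      by (rule emeasure_subadditive) (use A_meas in auto)
    also have "\<dots> \<le> ennreal ?b + ennreal (h t)"
      using IH assms by (intro add_mono) auto
    also have "\<dots> = ennreal (?b + h t)"
      using b assms by (simp add: ennreal_plus)
    finally show ?thesis
      using A_Suc unfolding X_def split by (simp add: algebra_simps)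
  qed
qed

lemma emeasure_sliding_windows:
  fixes h :: "nat \<Rightarrow> real"
  assumes "\<And>k. 0 \<le> h k" and "0 \<le> \<delta>"
    and "\<And>t. real (card {k. k < t \<and> Z k}) \<le> c" and "\<And>t. sum h {k. k < t \<and> \<not> Z k} \<le> b"
  shows "emeasure lborel (\<Union>i. {sum h {..<i} <..< sum h {..<i} + \<delta>}) \<le> ennreal (\<delta> * (1 + c) + b)"
proof -
  define A where "A t = (\<Union>i\<le>t. {sum h {..<i} <..< sum h {..<i} + \<delta>})" for t
  have "emeasure lborel (\<Union>t. A t) = (SUP t. emeasure lborel (A t))"
  proof (rule SUP_emeasure_incseq[symmetric])
    show "range A \<subseteq> sets lborel" unfolding A_def by auto
    show "incseq A" unfolding A_def by (rule incseq_SucI) (auto simp: atMost_Suc)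
  qed
  also have "\<dots> \<le> ennreal (\<delta> * (1 + c) + b)"
  proof (rule SUP_least)
    fix t
    have "emeasure lborel (A t)
        \<le> ennreal (\<delta> * (1 + real (card {k. k < t \<and> Z k})) + sum h {k. k < t \<and> \<not> Z k})"
      unfolding A_def by (rule emeasure_sliding_windows_finite) (use assms in auto)
    also have "\<dots> \<le> ennreal (\<delta> * (1 + c) + b)"
      using assms by (intro ennreal_leI add_mono mult_left_mono) auto
    finally show "emeasure lborel (A t) \<le> ennreal (\<delta> * (1 + c) + b)" .
  qed
  also have "(\<Union>t. A t) = (\<Union>i. {sum h {..<i} <..< sum h {..<i} + \<delta>})"
    unfolding A_def by auto
  finally show ?thesis .
qed

section \<open>Names and their reorderings\<close>

text \<open>At most \<open>u_count f j\<close> of the indices below \<open>t\<close> have exponent \<open>j\<close>. Finiteness of the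
  fibres matters here, since \<open>card\<close> would make an infinite fibre invisible.\<close>

lemma sum_le_reordered_block:
  assumes "name_for f x"
  shows "(\<Sum>k | k < t \<and> m \<le> f k \<and> f k < M. 1 / 2 ^ f k) \<le> (\<Sum>j=m..<M. real (u_count f j) / 2 ^ j)"
proof -
  let ?S = "{k. k < t \<and> m \<le> f k \<and> f k < M}"
  have "(\<Sum>k\<in>?S. 1 / 2 ^ f k) = (\<Sum>j=m..<M. \<Sum>k | k \<in> ?S \<and> f k = j. 1 / 2 ^ f k :: real)"
    by (rule sum.group[symmetric]) auto
  also have "\<dots> = (\<Sum>j=m..<M. real (card {k. k \<in> ?S \<and> f k = j}) / 2 ^ j)"
    by (intro sum.cong refl) simp
  also have "\<dots> \<le> (\<Sum>j=m..<M. real (u_count f j) / 2 ^ j)"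
    unfolding u_count_def
    by (intro sum_mono divide_right_mono of_nat_mono card_mono finite_name_for_fibre[OF assms]) auto
  finally show ?thesis .
qed

text \<open>Only finitely many exponents occur among the first \<open>t\<close> terms, so the sum is bounded by a
  finite block of the reordered series, and that block by the distance from the \<open>m\<close>-th partial sum to
  the limit \<open>y\<close>.\<close>

lemma tail_le_modulus:
  assumes name: "name_for f x"
    and lim: "(\<lambda>n. \<Sum>k<n. real (u_count f k) / 2 ^ k) \<longlonglongrightarrow> y"
    and bound: "\<bar>y - (\<Sum>k<m. real (u_count f k) / 2 ^ k)\<bar> \<le> \<epsilon>"
  shows "(\<Sum>k | k < t \<and> \<not> f k < m. 1 / 2 ^ f k) \<le> \<epsilon>"
proof -
  let ?X = "\<lambda>n. \<Sum>k<n. real (u_count f k) / 2 ^ k"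
  \<comment> \<open>any strict upper bound for \<open>m\<close> and the exponents of the first \<open>t\<close> terms would do\<close>
  define M where "M = Suc (m + (\<Sum>k<t. f k))"
  have "f k < M" if "k < t" for k
    using member_le_sum[of k "{..<t}" f] that unfolding M_def by auto
  then have "{k. k < t \<and> \<not> f k < m} = {k. k < t \<and> m \<le> f k \<and> f k < M}" by auto
  then have "(\<Sum>k | k < t \<and> \<not> f k < m. 1 / 2 ^ f k) \<le> (\<Sum>j=m..<M. real (u_count f j) / 2 ^ j)"
    using sum_le_reordered_block[OF name] by simp
  also have "\<dots> = ?X M - ?X m"
    using sum_diff_nat_ivl[of 0 m M "\<lambda>k. real (u_count f k) / 2 ^ k"]
    by (simp add: M_def atLeast0LessThan)
  also have "?X M \<le> y"
    by (rule incseq_le[OF _ lim]) (auto intro: incseq_SucI)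
  finally show ?thesis using bound by linarith
qed

text \<open>Each of the counted terms contributes at least \<open>1 / 2 ^ m\<close> to \<open>x\<close>.\<close>

lemma card_small_exponents:
  assumes "name_for f x"
  shows "real (card {k. k < t \<and> f k < m}) \<le> 2 ^ m * x"
proof -
  have sums: "(\<lambda>k. 1 / 2 ^ f k) sums x" using assms unfolding name_for_def .
  have "real (card {k. k < t \<and> f k < m}) * (1 / 2 ^ m) = (\<Sum>k | k < t \<and> f k < m. 1 / 2 ^ m)"
    by simp
  also have "\<dots> \<le> (\<Sum>k | k < t \<and> f k < m. 1 / 2 ^ f k)"
    by (intro sum_mono divide_left_mono power_increasing) auto
  also have "\<dots> \<le> suminf (\<lambda>k. 1 / 2 ^ f k)"
    by (rule sum_le_suminf) (use sums sums_summable in auto)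
  also have "\<dots> = x" using sums by (simp add: sums_iff)
  finally show ?thesis by (simp add: field_simps)
qed

text \<open>The windows are open on the left; that \<open>x\<close> still falls into one of them is due to every
  term being positive, so that no partial sum reaches \<open>x\<close>.\<close>

lemma name_in_window:
  assumes "name_for f x" and "0 < \<delta>"
  shows "x \<in> (\<Union>t. {(\<Sum>k<t. 1 / 2 ^ f k) <..< (\<Sum>k<t. 1 / 2 ^ f k) + \<delta>})"
proof -
  have sums: "(\<lambda>k. 1 / 2 ^ f k) sums x" using assms(1) unfolding name_for_def .
  then have "(\<lambda>t. \<Sum>k<t. 1 / 2 ^ f k) \<longlonglongrightarrow> x" unfolding sums_def .
  then have "\<forall>\<^sub>F t in sequentially. x - \<delta> < (\<Sum>k<t. 1 / 2 ^ f k)"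
    by (rule order_tendstoD) (use assms(2) in simp)
  then obtain t where "x - \<delta> < (\<Sum>k<t. 1 / 2 ^ f k)"
    by (metis eventually_sequentially order_refl)
  moreover have "(\<Sum>k<t. 1 / 2 ^ f k) < suminf (\<lambda>k. 1 / 2 ^ f k :: real)"
    by (rule sum_less_suminf) (use sums sums_summable in auto)
  ultimately show ?thesis using sums by (auto simp: sums_iff)
qed

theorem corollary24:
  fixes x :: real
  assumes "reordered_computable x"
  shows "\<not> ml_random x"
proof -
  obtain f y s where f: "computable f" and name: "name_for f x"
    and lim: "(\<lambda>n. \<Sum>k<n. real (u_count f k) / 2 ^ k) \<longlonglongrightarrow> y" and s: "computable s"
    and modulus: "\<And>n k. s n \<le> k \<Longrightarrow> \<bar>y - (\<Sum>k<k. real (u_count f k) / 2 ^ k)\<bar> \<le> 1 / 2 ^ n"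
    using assms unfolding reordered_computable_def series_converges_computably_def
      converges_computably_def by blast
  obtain c where c: "x + 2 < 2 ^ c" using real_arch_pow[of 2 "x + 2"] by auto
  \<comment> \<open>\<open>s (n + c)\<close> compensates the number of large steps; \<open>n + c\<close> makes their total cost small\<close>
  define e where "e n = s (n + c) + (n + c)" for n
  define U where "U n = (\<Union>t. {(\<Sum>k<t. 1 / 2 ^ f k) <..< (\<Sum>k<t. 1 / 2 ^ f k) + 1 / 2 ^ e n :: real})" for n
  have "computable e" unfolding e_def computable_iff_recursive
    by (intro recursive_add recursive_computable[OF s] recursive_const recursive_nth) auto
  then have "uniformly_ce_open U" unfolding U_def
    by (rule uniformly_ce_open_partial_sums[OF f])
  moreover have "emeasure lborel (U n) \<le> ennreal (1 / 2 ^ n)" for n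
  proof -
    define m where "m = s (n + c)"
    have "emeasure lborel (U n) \<le> ennreal (1 / 2 ^ e n * (1 + 2 ^ m * x) + 1 / 2 ^ (n + c))"
      unfolding U_def
    proof (rule emeasure_sliding_windows[where Z = "\<lambda>k. f k < m"])
      show "real (card {k. k < t \<and> f k < m}) \<le> 2 ^ m * x" for t
        by (rule card_small_exponents[OF name])
      show "(\<Sum>k | k < t \<and> \<not> f k < m. 1 / 2 ^ f k) \<le> (1 / 2 ^ (n + c) :: real)" for t
        by (rule tail_le_modulus[OF name lim modulus]) (simp add: m_def)
    qed auto
    also have "1 / 2 ^ e n * (1 + 2 ^ m * x) + 1 / 2 ^ (n + c) = (1 / 2 ^ m + x + 1) / 2 ^ (n + c)"
      unfolding e_def m_def by (simp add: power_add field_simps)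
    also have "\<dots> \<le> 2 ^ c / 2 ^ (n + c)"
    proof (rule divide_right_mono)
      have "1 / 2 ^ m \<le> (1 :: real)" by simp
      then show "1 / 2 ^ m + x + 1 \<le> 2 ^ c" using c by linarith
    qed simp
    also have "\<dots> = 1 / 2 ^ n" by (simp add: power_add)
    finally show ?thesis by (simp add: ennreal_leI)
  qed
  moreover have "x \<in> (\<Inter>n. U n)"
    unfolding U_def using name_in_window[OF name] by simp
  ultimately show ?thesis unfolding ml_random_def by blast
qed

end
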